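(* Let $\alpha<0$ and $\varepsilon\in\{0,1\}$, and consider the focusing initial value problem $$\begin{cases} i\partial_t u+\varepsilon\partial_x^2u+\partial_y^2u+\alpha\partial_x^4u=-|u|^2u, & t\in\mathbb{R},\ (x,y)\in\mathbb{T}\times\mathbb{R},\\ u(0,x,y)=\phi(x,y).\end{cases}$$ If $-\tfrac12\le s<0$, then this initial value problem is ill-posed in $H^s(\mathbb{T}\times\mathbb{R})$ in the sense that the data-solution mapping $\phi\mapsto u$, from $H^s(\mathbb{T}\times\mathbb{R})$ into $C([0,T];H^s(\mathbb{T}\times\mathbb{R}))$, $T>0$, is not uniformly continuous on bounded sets of initial data in $H^s(\mathbb{T}\times\mathbb{R})$.
   Context: $\mathbb{T}=\mathbb{R}/2\pi\mathbb{Z}$; $u$ is complex valued. The Sobolev norm is $\|f\|_{H^s(\mathbb{T}\times\mathbb{R})}^2=\sum_{k\in\mathbb{Z}}\int_{\mathbb{R}}(1+|\xi|+|k|)^{2s}|\widehat f(k,\xi)|^2\,d\xi$, where $(k,\xi)\in\mathbb{Z}\times\mathbb{R}$ are the Fourier variables dual to $(x,y)\in\mathbb{T}\times\mathbb{R}$. Failure of uniform continuity on bounded sets means: there exist two sequences of solutions $u_n,v_n$ of the equation, whose initial data are bounded in $H^s(\mathbb{T}\times\mathbb{R})$ uniformly in $n$, such that $\|u_n(0)-v_n(0)\|_{H^s}\to0$ as $n\to\infty$ while $\sup_{t\in[0,T]}\|u_n(t)-v_n(t)\|_{H^s}\not\to0$. *)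

theory Defs
  imports "HOL-Analysis.Analysis"
begin

text \<open>
  Functions on \<open>\<T> \<times> \<real>\<close>, with \<open>\<T> = \<real>/2\<pi>\<int>\<close>, are represented by functions
  \<open>real \<Rightarrow> real \<Rightarrow> complex\<close> that are \<open>2\<pi>\<close>-periodic in the first argument; integrals over
  \<open>\<T> \<times> \<real>\<close> are taken over one period.
\<close>

definition period_strip :: "(real \<times> real) set" where
  "period_strip = {0..2 * pi} \<times> UNIV"

definition periodic_x :: "(real \<Rightarrow> real \<Rightarrow> complex) \<Rightarrow> bool" where
  "periodic_x f \<longleftrightarrow> (\<forall>x y. f (x + 2 * pi) y = f x y)"

definition integrable_TR :: "(real \<Rightarrow> real \<Rightarrow> complex) \<Rightarrow> bool" where
  "integrable_TR f \<longleftrightarrow> set_integrable lborel period_strip (\<lambda>(x, y). f x y)"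

text \<open>
  The factor \<open>1/(2\<pi>)\<close> makes the transform unitary from \<open>L\<^sup>2(\<T> \<times> \<real>)\<close> to \<open>L\<^sup>2(\<int> \<times> \<real>)\<close>.
\<close>

definition fourier_TR :: "(real \<Rightarrow> real \<Rightarrow> complex) \<Rightarrow> int \<Rightarrow> real \<Rightarrow> complex" where
  "fourier_TR f k \<xi> =
     1 / (2 * pi) *
     (LINT (x, y):period_strip|lborel. f x y * exp (- \<i> * of_real (of_int k * x + \<xi> * y)))"

definition sobolev_sq :: "real \<Rightarrow> (real \<Rightarrow> real \<Rightarrow> complex) \<Rightarrow> ennreal" where
  "sobolev_sq s f =
     (\<integral>\<^sup>+ k. \<integral>\<^sup>+ \<xi>. ennreal ((1 + \<bar>\<xi>\<bar> + \<bar>of_int k\<bar>) powr (2 * s) * (cmod (fourier_TR f k \<xi>))\<^sup>2)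
        \<partial>lborel \<partial>count_space UNIV)"

definition sobolev_norm :: "real \<Rightarrow> (real \<Rightarrow> real \<Rightarrow> complex) \<Rightarrow> real" where
  "sobolev_norm s f = sqrt (enn2real (sobolev_sq s f))"

text \<open>
  For \<open>s < 0\<close> the space \<open>H\<^sup>s(\<T> \<times> \<real>)\<close> also contains distributions, for which \<open>|u|\<^sup>2 u\<close> has no
  meaning. The predicate below describes its elements that are integrable functions, so that
  the Fourier transform is given by its integral formula and the norm above is not a junk value.
\<close>

definition in_sobolev :: "real \<Rightarrow> (real \<Rightarrow> real \<Rightarrow> complex) \<Rightarrow> bool" where
  "in_sobolev s f \<longleftrightarrow> periodic_x f \<and> integrable_TR f \<and> sobolev_sq s f < \<infinity>"

definition sobolev_dist ::
    "real \<Rightarrow> (real \<Rightarrow> real \<Rightarrow> complex) \<Rightarrow> (real \<Rightarrow> real \<Rightarrow> complex) \<Rightarrow> real" where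
  "sobolev_dist s f g = sobolev_norm s (\<lambda>x y. f x y - g x y)"

text \<open>Membership in \<open>C([0,T]; H\<^sup>s(\<T> \<times> \<real>))\<close>.\<close>

definition continuous_into_sobolev ::
    "real \<Rightarrow> real \<Rightarrow> (real \<Rightarrow> real \<Rightarrow> real \<Rightarrow> complex) \<Rightarrow> bool" where
  "continuous_into_sobolev s T u \<longleftrightarrow>
     (\<forall>t\<in>{0..T}. in_sobolev s (u t) \<and>
        ((\<lambda>\<tau>. sobolev_dist s (u \<tau>) (u t)) \<longlongrightarrow> 0) (at t within {0..T}))"

text \<open>Partial derivatives of a function of \<open>(t, x, y)\<close>.\<close>

definition Dt ::
    "(real \<Rightarrow> real \<Rightarrow> real \<Rightarrow> complex) \<Rightarrow> real \<Rightarrow> real \<Rightarrow> real \<Rightarrow> complex" where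
  "Dt u t x y = vector_derivative (\<lambda>\<tau>. u \<tau> x y) (at t)"

definition Dx ::
    "(real \<Rightarrow> real \<Rightarrow> real \<Rightarrow> complex) \<Rightarrow> real \<Rightarrow> real \<Rightarrow> real \<Rightarrow> complex" where
  "Dx u t x y = vector_derivative (\<lambda>\<xi>. u t \<xi> y) (at x)"

definition Dy ::
    "(real \<Rightarrow> real \<Rightarrow> real \<Rightarrow> complex) \<Rightarrow> real \<Rightarrow> real \<Rightarrow> real \<Rightarrow> complex" where
  "Dy u t x y = vector_derivative (\<lambda>\<eta>. u t x \<eta>) (at y)"

definition jointly_continuous :: "(real \<Rightarrow> real \<Rightarrow> real \<Rightarrow> complex) \<Rightarrow> bool" where
  "jointly_continuous u \<longleftrightarrow> continuous_on UNIV (\<lambda>(t, x, y). u t x y)"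

text \<open>
  All derivatives occurring in the equation, and those of lower order, exist and are continuous:
  \<open>u\<close> is once differentiable in \<open>t\<close>, four times in \<open>x\<close> and twice in \<open>y\<close>.
\<close>

definition classically_regular :: "(real \<Rightarrow> real \<Rightarrow> real \<Rightarrow> complex) \<Rightarrow> bool" where
  "classically_regular u \<longleftrightarrow>
     (\<forall>t x y. (\<lambda>\<tau>. u \<tau> x y) differentiable (at t)) \<and> jointly_continuous (Dt u) \<and>
     (\<forall>j<4. \<forall>t x y. (\<lambda>\<xi>. (Dx ^^ j) u t \<xi> y) differentiable (at x)) \<and>
     (\<forall>j\<le>4. jointly_continuous ((Dx ^^ j) u)) \<and>
     (\<forall>j<2. \<forall>t x y. (\<lambda>\<eta>. (Dy ^^ j) u t x \<eta>) differentiable (at y)) \<and>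
     (\<forall>j\<le>2. jointly_continuous ((Dy ^^ j) u))"

text \<open>
  Bounds in \<open>L\<^sup>1 \<inter> L\<^sup>\<infinity>\<close>, uniform on bounded time intervals. With them a classical solution
  satisfies the Duhamel formula in \<open>L\<^sup>2\<close> and is determined by its initial value, so that the
  solutions considered are values of a well-defined data-solution mapping.
\<close>

definition locally_bounded_L1_Linf :: "(real \<Rightarrow> real \<Rightarrow> real \<Rightarrow> complex) \<Rightarrow> bool" where
  "locally_bounded_L1_Linf u \<longleftrightarrow>
     (\<forall>R. \<exists>B. \<forall>t\<in>{-R..R}. integrable_TR (u t) \<and>
        (LINT (x, y):period_strip|lborel. cmod (u t x y)) \<le> B \<and>
        (\<forall>x y. cmod (u t x y) \<le> B))"

definition solves_ivp ::
    "real \<Rightarrow> real \<Rightarrow> (real \<Rightarrow> real \<Rightarrow> complex) \<Rightarrow> (real \<Rightarrow> real \<Rightarrow> real \<Rightarrow> complex) \<Rightarrow> bool" where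
  "solves_ivp \<epsilon> \<alpha> \<phi> u \<longleftrightarrow>
     (\<forall>t. periodic_x (u t)) \<and> classically_regular u \<and> locally_bounded_L1_Linf u \<and>
     (\<forall>t x y. \<i> * Dt u t x y + of_real \<epsilon> * (Dx ^^ 2) u t x y + (Dy ^^ 2) u t x y
                + of_real \<alpha> * (Dx ^^ 4) u t x y
              = - (of_real ((cmod (u t x y))\<^sup>2) * u t x y)) \<and>
     (\<forall>x y. u 0 x y = \<phi> x y)"

text \<open>
  The graph of the data-solution mapping \<open>\<phi> \<mapsto> u\<close> from \<open>H\<^sup>s\<close> to \<open>C([0,T]; H\<^sup>s)\<close>; the condition
  \<open>\<phi> \<in> H\<^sup>s\<close> is the case \<open>t = 0\<close> of the last conjunct.
\<close>

definition data_solution ::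
    "real \<Rightarrow> real \<Rightarrow> real \<Rightarrow> real \<Rightarrow> (real \<Rightarrow> real \<Rightarrow> complex) \<Rightarrow>
     (real \<Rightarrow> real \<Rightarrow> real \<Rightarrow> complex) \<Rightarrow> bool" where
  "data_solution \<epsilon> \<alpha> s T \<phi> u \<longleftrightarrow> solves_ivp \<epsilon> \<alpha> \<phi> u \<and> continuous_into_sobolev s T u"

end

theory Submission
  imports Defs "HOL-Probability.Sinc_Integral"
begin

text \<open>
  For a frequency \<open>k\<close> and a width \<open>\<omega>\<close> the equation has the exact solution
  \<open>exp (\<i> (k x + \<mu> t)) \<surd>2 \<omega> sech (\<omega> y)\<close> with \<open>\<mu> = \<omega>\<^sup>2 - \<epsilon> k\<^sup>2 + \<alpha> k\<^sup>4\<close>. If \<open>\<omega> \<le> k\<close>, the Fourier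
  transform lives at frequencies of size \<open>k\<close>, so the squared \<open>H\<^sup>s\<close> norm is comparable to
  \<open>k\<^bsup>2s\<^esup> \<omega>\<close>; the choice \<open>\<omega> = k\<^bsup>-2s\<^esup>\<close>, which satisfies \<open>\<omega> \<le> k\<close> because \<open>s \<ge> -1/2\<close>, makes it
  comparable to 1. Since \<open>s < 0\<close>, this width tends to infinity with \<open>k\<close>, and raising \<open>\<omega>\<^sup>2\<close> by
  \<open>\<pi>/T\<close> changes \<open>\<omega>\<close>, hence the initial value, only by a factor tending to 1. At time \<open>T\<close>,
  however, the two solutions have acquired opposite phases, and their distance is of order 1.
\<close>

section \<open>The hyperbolic secant and its Fourier transform on the line\<close>

text \<open>Since \<open>1 + sinh\<^sup>2 = cosh\<^sup>2\<close>, the function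
  \<open>arctan (sinh y)\<close> is an antiderivative, with limits -pi/2 and pi/2. As the integrand
  is nonnegative, the fundamental theorem of calculus yields integrability together with the
  value.\<close>

lemma sech_integral:
  shows integrable_sech: "integrable lborel (\<lambda>y. inverse (cosh y) :: real)"
    and integral_sech: "(LBINT y. inverse (cosh y)) = pi"
proof -
  let ?F = "\<lambda>y::real. arctan (sinh y)"
  have *: "DERIV ?F y :> inverse (cosh y)" for y
  proof -
    have "inverse (1 + (sinh y)\<^sup>2) * cosh y = inverse (cosh y)"
      unfolding add.commute[of 1] cosh_square_eq[symmetric] by (simp add: power2_eq_square)
    then show ?thesis
      by (auto intro!: derivative_eq_intros)
  qed
  have "((?F \<circ> real_of_ereal) \<longlongrightarrow> -(pi/2)) (at_right (-\<infinity>))"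
    "((?F \<circ> real_of_ereal) \<longlongrightarrow> pi/2) (at_left \<infinity>)"
    unfolding ereal_tendsto_simps
    by (rule filterlim_compose[OF tendsto_arctan_at_bot sinh_real_at_bot]
             filterlim_compose[OF tendsto_arctan_at_top sinh_real_at_top])+
  note * = interval_integral_FTC_nonneg[of "-\<infinity>" \<infinity>, OF _ * _ _ this]
  have "set_integrable lborel (einterval (-\<infinity>) \<infinity>) (\<lambda>y. inverse (cosh y) :: real)"
    by (rule *) (auto intro!: continuous_intros)
  then show "integrable lborel (\<lambda>y. inverse (cosh y) :: real)"
    by (simp add: set_integrable_def)
  have "(LBINT y=-\<infinity>..\<infinity>. inverse (cosh y)) = pi/2 - (-(pi/2))"
    by (rule *) (auto intro!: continuous_intros)
  then show "(LBINT y. inverse (cosh y)) = pi"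
    by (simp add: interval_lebesgue_integral_def set_lebesgue_integral_def)
qed

text \<open>The unnormalised transform, with closed form \<open>pi / cosh (pi * \<eta> / 2)\<close>.
  It enters below through its continuity, its value at 0 and a decay like
  \<open>1 / \<bar>\<eta>\<bar>\<close>.\<close>

definition sech_hat :: "real \<Rightarrow> complex" where
  "sech_hat \<eta> = (LBINT y. of_real (inverse (cosh y)) * exp (- \<i> * of_real (\<eta> * y)))"

lemma integrable_mult_character:
  fixes g :: "real \<Rightarrow> complex"
  assumes "integrable lborel g"
  shows "integrable lborel (\<lambda>y. g y * exp (- \<i> * of_real (\<eta> * y)))"
proof (rule Bochner_Integration.integrable_bound[OF assms])
  have "continuous_on UNIV (\<lambda>y. exp (- \<i> * complex_of_real (\<eta> * y)))"
    by (intro continuous_intros)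
  then have "(\<lambda>y. exp (- \<i> * complex_of_real (\<eta> * y))) \<in> borel_measurable lborel"
    by (simp add: borel_measurable_continuous_onI)
  with assms show "(\<lambda>y. g y * exp (- \<i> * complex_of_real (\<eta> * y))) \<in> borel_measurable lborel"
    by (intro borel_measurable_times) auto
qed (simp add: norm_mult)

lemma norm_sech_hat_le: "norm (sech_hat \<eta>) \<le> pi"
proof -
  have "norm (sech_hat \<eta>)
      \<le> (LBINT y. norm (of_real (inverse (cosh y)) * exp (- \<i> * complex_of_real (\<eta> * y))))"
    unfolding sech_hat_def by (rule integral_norm_bound)
  also have "\<dots> = pi"
    by (simp add: norm_mult norm_inverse flip: integral_sech)
  finally show ?thesis .
qed

lemma sech_hat_0: "sech_hat 0 = of_real pi"
  unfolding sech_hat_def using integral_of_real[OF integrable_sech, where 'a=complex]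
  by (simp add: integral_sech)

text \<open>Integration by parts gives \<open>i \<eta> sech_hat \<eta>\<close> as the transform of \<open>sech'\<close>, and
  \<open>\<bar>sech'\<bar> \<le> sech\<close>.\<close>

lemma norm_times_sech_hat_le: "norm (\<eta> * sech_hat \<eta>) \<le> pi"
proof -
  define E where "E y = exp (- \<i> * complex_of_real (\<eta> * y))" for y
  define S :: "real \<Rightarrow> complex" where "S y = of_real (inverse (cosh y))" for y
  define S' :: "real \<Rightarrow> complex" where "S' y = - of_real (sinh y / (cosh y)\<^sup>2)" for y
  \<comment> \<open>The character is differentiated as an entire function of a complex variable and
    then restricted to the real line; the same device serves the other exponentials below.\<close>
  have E: "(E has_vector_derivative - \<i> * of_real \<eta> * E y) (at y)" for y
  proof -
    have "((\<lambda>z. exp (- \<i> * (of_real \<eta> * z))) has_field_derivative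
        - \<i> * of_real \<eta> * exp (- \<i> * (of_real \<eta> * of_real y))) (at (of_real y))"
      by (auto intro!: derivative_eq_intros)
    from has_vector_derivative_real_field[OF this] show ?thesis
      by (simp add: E_def[abs_def])
  qed
  have S: "(S has_vector_derivative S' y) (at y)" for y
  proof -
    have "((\<lambda>y. inverse (cosh y)) has_real_derivative - (sinh y / (cosh y)\<^sup>2)) (at y)"
      by (auto intro!: derivative_eq_intros simp: power2_eq_square divide_inverse)
    then have "((\<lambda>y. inverse (cosh y)) has_vector_derivative - (sinh y / (cosh y)\<^sup>2)) (at y)"
      by (simp add: has_real_derivative_iff_has_vector_derivative)
    then show ?thesis
      unfolding S_def[abs_def] S'_def of_real_minus[symmetric]
      by (rule bounded_linear.has_vector_derivative[OF bounded_linear_of_real])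
  qed
  have nS: "norm (S y) = inverse (cosh y)" for y
    by (simp add: S_def norm_inverse)
  have nE: "norm (E y) = 1" for y
    by (simp add: E_def)
  have nS': "norm (S' y) \<le> inverse (cosh y)" for y :: real
  proof -
    have "\<bar>sinh y\<bar> \<le> cosh y"
      by (rule abs_le_square_iff[THEN iffD2, of "sinh y" "cosh y", simplified])
         (simp add: cosh_square_eq)
    then show ?thesis
      by (simp add: S'_def norm_divide power2_eq_square field_simps norm_mult)
  qed
  have contE: "continuous_on UNIV E" "isCont E y" for y
    unfolding E_def by (intro continuous_intros)+
  have contS: "continuous_on UNIV S" "isCont S y" for y
    unfolding S_def by (intro continuous_intros; simp)+
  have contS': "continuous_on UNIV S'" "isCont S' y" for y
    unfolding S'_def by (intro continuous_intros; simp)+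
  have iS: "integrable lborel S"
    unfolding S_def by (intro integrable_of_real integrable_sech)
  have iS': "integrable lborel S'"
    by (rule Bochner_Integration.integrable_bound[OF integrable_sech])
       (auto simp: nS' borel_measurable_continuous_onI contS')
  note i = integrable_mult_character[OF iS, of \<eta>] integrable_mult_character[OF iS', of \<eta>]
  note i = i[folded E_def]
  have 1: "integrable lborel (\<lambda>y. S y * (- \<i> * of_real \<eta> * E y) + S' y * E y)"
    using Bochner_Integration.integrable_add[OF integrable_mult_right[OF i(1), of "- \<i> * of_real \<eta>"] i(2)]
    by (simp add: algebra_simps)
  have lim: "((\<lambda>y. S y * E y) \<longlongrightarrow> 0) at_top" "((\<lambda>y. S y * E y) \<longlongrightarrow> 0) at_bot"
    by (rule tendsto_norm_zero_cancel, simp add: norm_mult nS nE,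
        intro tendsto_inverse_0_at_top cosh_real_at_top cosh_real_at_bot)+
  \<comment> \<open>The integrand is the derivative of \<open>S y * E y\<close>; both boundary terms
    vanish because \<open>S\<close> decays and \<open>E\<close> has modulus 1.\<close>
  have "(LBINT y=-\<infinity>..\<infinity>. S y * (- \<i> * of_real \<eta> * E y) + S' y * E y) = 0 - 0"
  proof (rule interval_integral_FTC_integrable)
    show "((\<lambda>y. S y * E y) has_vector_derivative S y * (- \<i> * of_real \<eta> * E y) + S' y * E y) (at y)" for y
      using has_vector_derivative_mult[OF S E] .
    show "isCont (\<lambda>y. S y * (- \<i> * of_real \<eta> * E y) + S' y * E y) y" for y
      by (intro continuous_intros contE contS contS')
    show "(((\<lambda>y. S y * E y) \<circ> real_of_ereal) \<longlongrightarrow> 0) (at_right (-\<infinity>))"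
      "(((\<lambda>y. S y * E y) \<circ> real_of_ereal) \<longlongrightarrow> 0) (at_left \<infinity>)"
      unfolding ereal_tendsto_simps by (fact lim)+
  qed (use 1 in \<open>simp_all add: set_integrable_def\<close>)
  then have "(LBINT y. S y * (- \<i> * of_real \<eta> * E y) + S' y * E y) = 0"
    by (simp add: interval_lebesgue_integral_def set_lebesgue_integral_def)
  also have "(\<lambda>y. S y * (- \<i> * of_real \<eta> * E y) + S' y * E y)
      = (\<lambda>y. (- \<i> * of_real \<eta>) * (S y * E y) + S' y * E y)"
    by (simp add: fun_eq_iff)
  also have "(LBINT y. (- \<i> * of_real \<eta>) * (S y * E y) + S' y * E y)
      = (- \<i> * of_real \<eta>) * (LBINT y. S y * E y) + (LBINT y. S' y * E y)"
    using i by (subst Bochner_Integration.integral_add) auto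
  also have "(LBINT y. S y * E y) = sech_hat \<eta>"
    by (simp add: sech_hat_def S_def E_def)
  finally have "\<i> * (of_real \<eta> * sech_hat \<eta>) = (LBINT y. S' y * E y)"
    by (simp add: algebra_simps)
  then have "norm (of_real \<eta> * sech_hat \<eta>) = norm (LBINT y. S' y * E y)"
    by (metis norm_ii norm_mult mult_1)
  also have "\<dots> \<le> (LBINT y. norm (S' y * E y))"
    by (rule integral_norm_bound)
  also have "\<dots> \<le> (LBINT y. inverse (cosh y))"
    using i by (intro integral_mono integrable_norm integrable_sech) (auto simp: norm_mult nE nS')
  finally show ?thesis
    by (simp add: integral_sech)
qed

text \<open>Squaring and adding \<open>norm_sech_hat_le\<close> and
  \<open>norm_times_sech_hat_le\<close> produces the factor \<open>1 + \<eta>\<^sup>2\<close>. The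
  majorant has an explicit integral and serves both for norm bounds and for dominated
  convergence.\<close>

lemma norm_sech_hat_sq_le: "(norm (sech_hat \<eta>))\<^sup>2 \<le> 2 * pi\<^sup>2 * inverse (1 + \<eta>\<^sup>2)"
proof -
  have "(norm (sech_hat \<eta>))\<^sup>2 \<le> pi\<^sup>2" "(norm (\<eta> * sech_hat \<eta>))\<^sup>2 \<le> pi\<^sup>2"
    by (intro power_mono norm_sech_hat_le norm_times_sech_hat_le norm_ge_zero)+
  moreover have "(norm (sech_hat \<eta>))\<^sup>2 * (1 + \<eta>\<^sup>2)
      = (norm (sech_hat \<eta>))\<^sup>2 + (norm (\<eta> * sech_hat \<eta>))\<^sup>2"
    by (simp add: norm_mult power_mult_distrib algebra_simps)
  ultimately have "(norm (sech_hat \<eta>))\<^sup>2 * (1 + \<eta>\<^sup>2) \<le> 2 * pi\<^sup>2"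
    by linarith
  then show ?thesis
    by (simp add: field_simps add_pos_nonneg)
qed

text \<open>Dominated convergence along sequences: the characters have modulus 1, so sech itself is
  the majorant.\<close>

lemma isCont_sech_hat: "isCont sech_hat \<eta>"
  unfolding continuous_at_sequentially o_def
proof (intro allI impI)
  fix X :: "nat \<Rightarrow> real"
  assume X: "X \<longlonglongrightarrow> \<eta>"
  show "(\<lambda>n. sech_hat (X n)) \<longlonglongrightarrow> sech_hat \<eta>"
    unfolding sech_hat_def
  proof (rule integral_dominated_convergence[where w = "\<lambda>y. inverse (cosh y)"])
    have *: "(\<lambda>y. of_real (inverse (cosh y)) * exp (- \<i> * complex_of_real (c * y)))
        \<in> borel_measurable lborel" for c
      by (rule borel_measurable_integrable, rule integrable_mult_character)
         (intro integrable_of_real integrable_sech)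
    show "(\<lambda>y. of_real (inverse (cosh y)) * exp (- \<i> * complex_of_real (\<eta> * y)))
        \<in> borel_measurable lborel"
      "(\<lambda>y. of_real (inverse (cosh y)) * exp (- \<i> * complex_of_real (X n * y)))
        \<in> borel_measurable lborel" for n
      by (rule *)+
  qed (auto intro!: integrable_sech tendsto_intros X simp: norm_mult norm_inverse)
qed

lemma measurable_sech_hat [measurable]: "sech_hat \<in> borel_measurable borel"
  by (intro borel_measurable_continuous_onI continuous_at_imp_continuous_on ballI isCont_sech_hat)

section \<open>Functions with a single Fourier mode in x\<close>

lemma lborel_tensor_integral:
  fixes g h :: "real \<Rightarrow> complex"
  assumes g: "integrable lborel g" and h: "integrable lborel h"
  shows "integrable lborel (\<lambda>(x, y). g x * h y)"
    and "(LINT (x, y)|lborel. g x * h y) = (LBINT x. g x) * (LBINT y. h y)"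
proof -
  have [measurable]: "g \<in> borel_measurable lborel" "h \<in> borel_measurable lborel"
    using g h by auto
  have *: "integrable (lborel \<Otimes>\<^sub>M lborel) (\<lambda>(x, y). g x * h y)"
    by (rule lborel_pair.Fubini_integrable) (use g h in \<open>auto simp: norm_mult\<close>)
  then show "integrable lborel (\<lambda>(x, y). g x * h y)"
    by (simp add: lborel_prod)
  have "(LINT (x, y)|lborel. g x * h y) = (LBINT x. LBINT y. g x * h y)"
    using lborel_pair.integral_fst'[OF *] by (simp add: lborel_prod case_prod_beta)
  then show "(LINT (x, y)|lborel. g x * h y) = (LBINT x. g x) * (LBINT y. h y)"
    by simp
qed

text \<open>Orthogonality of the characters of the circle: for nonzero m the antiderivative takes
  equal values at 0 and \<open>2 * pi\<close>.\<close>

lemma integral_character_period: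
  fixes m :: int
  shows "(LBINT x. indicator {0..2 * pi} x * exp (\<i> * complex_of_real (m * x)))
    = (if m = 0 then 2 * pi else 0)" (is "?l = _")
proof (cases "m = 0")
  case True
  have "(LBINT x. complex_of_real (indicator {0..2*pi} x)) = of_real (LBINT x. indicator {0..2*pi} x)"
    by (rule integral_of_real) simp
  with True show ?thesis
    by (simp add: of_real_indicator)
next
  case False
  let ?F = "\<lambda>x::real. exp (\<i> * complex_of_real (m * x)) / (\<i> * m)"
  have "(LBINT x. indicator {0..2 * pi} x *\<^sub>R exp (\<i> * complex_of_real (m * x)))
      = ?F (2 * pi) - ?F 0"
  proof (rule integral_FTC_Icc)
    show "(?F has_vector_derivative exp (\<i> * complex_of_real (m * x))) (at x within {0..2 * pi})" for x :: real
    proof -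
      have "((\<lambda>z. exp (\<i> * (of_int m * z)) / (\<i> * m)) has_field_derivative
          exp (\<i> * (of_int m * complex_of_real x))) (at (of_real x))"
        using False by (auto intro!: derivative_eq_intros simp: mult_ac)
      from has_vector_derivative_real_field[OF this] show ?thesis
        by simp
    qed
  qed (auto intro!: continuous_intros)
  also have "exp (\<i> * complex_of_real (m * (2 * pi))) = 1"
    using exp_integer_2pi[of "of_int m"] by (simp add: mult_ac)
  finally show ?thesis
    using False by (simp add: scaleR_conv_of_real of_real_indicator)
qed

lemma mode_integrable_integral:
  fixes g :: "real \<Rightarrow> complex" and k :: int
  assumes "integrable lborel g"
  shows "set_integrable lborel period_strip
      (\<lambda>(x, y). exp (\<i> * of_real (real_of_int k * x)) * g y)"
    and "(LINT (x, y):period_strip|lborel. exp (\<i> * of_real (real_of_int k * x)) * g y)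
      = (if k = 0 then 2 * pi else 0) * (LBINT y. g y)"
proof -
  let ?e = "\<lambda>x::real. indicator {0..2 * pi} x * exp (\<i> * complex_of_real (real_of_int k * x))"
  have "integrable lborel (\<lambda>x. indicator {0..2 * pi} x *\<^sub>R exp (\<i> * complex_of_real (real_of_int k * x)))"
    by (rule borel_integrable_compact) (auto intro!: continuous_intros)
  then have e: "integrable lborel ?e"
    by (simp add: scaleR_conv_of_real of_real_indicator)
  \<comment> \<open>The indicator of the strip depends on x alone and is absorbed into
    \<open>?e\<close>, which gives the integrand product form.\<close>
  have eq: "(\<lambda>(x, y). ?e x * g y)
      = (\<lambda>z. indicator period_strip z *\<^sub>R (case z of (x, y) \<Rightarrow> exp (\<i> * of_real (real_of_int k * x)) * g y))"
    by (auto simp: fun_eq_iff period_strip_def indicator_def)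
  show "set_integrable lborel period_strip (\<lambda>(x, y). exp (\<i> * of_real (real_of_int k * x)) * g y)"
    using lborel_tensor_integral(1)[OF e assms] by (simp only: eq set_integrable_def)
  show "(LINT (x, y):period_strip|lborel. exp (\<i> * of_real (real_of_int k * x)) * g y)
      = (if k = 0 then 2 * pi else 0) * (LBINT y. g y)"
    using lborel_tensor_integral(2)[OF e assms]
    by (simp only: eq set_lebesgue_integral_def integral_character_period)
qed

text \<open>Orthogonality in x removes every mode but k, where the factor \<open>2 * pi\<close>
  cancels the normalisation of \<open>fourier_TR\<close>. The transform left in y is therefore
  unnormalised, like \<open>sech_hat\<close>.\<close>

lemma fourier_TR_mode:
  fixes g :: "real \<Rightarrow> complex" and k m :: int
  assumes "integrable lborel g"
  shows "fourier_TR (\<lambda>x y. exp (\<i> * of_real (real_of_int k * x)) * g y) m \<xi>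
    = (if m = k then LBINT y. g y * exp (- \<i> * of_real (\<xi> * y)) else 0)"
proof -
  have eq: "exp (\<i> * of_real (real_of_int k * x)) * g y * exp (- \<i> * of_real (of_int m * x + \<xi> * y))
      = exp (\<i> * of_real (of_int (k - m) * x)) * (g y * exp (- \<i> * of_real (\<xi> * y)))" for x y :: real
  proof -
    have "exp (\<i> * complex_of_real (real_of_int k * x)) * exp (- \<i> * of_real (of_int m * x + \<xi> * y))
        = exp (\<i> * of_real (of_int (k - m) * x)) * exp (- \<i> * of_real (\<xi> * y))"
      unfolding exp_add[symmetric] by (simp add: algebra_simps)
    then show ?thesis
      by (simp add: mult_ac)
  qed
  show ?thesis
    unfolding fourier_TR_def eq
      mode_integrable_integral(2)[OF integrable_mult_character[OF assms]]
    by simp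
qed

lemma sobolev_sq_mode:
  fixes g :: "real \<Rightarrow> complex" and k :: int
  assumes "integrable lborel g"
  shows "sobolev_sq s (\<lambda>x y. exp (\<i> * of_real (real_of_int k * x)) * g y)
    = (\<integral>\<^sup>+ \<xi>. ennreal ((1 + \<bar>\<xi>\<bar> + \<bar>of_int k\<bar>) powr (2 * s)
        * (cmod (LBINT y. g y * exp (- \<i> * of_real (\<xi> * y))))\<^sup>2) \<partial>lborel)"
  unfolding sobolev_sq_def fourier_TR_mode[OF assms]
  by (subst nn_integral_count_space'[of "{k}"]) auto

section \<open>The soliton profile, its differential equation and its transform\<close>

text \<open>The bright soliton of the one-dimensional cubic Schroedinger equation. The amplitude is
  tied to \<omega> so that the profile q satisfies
  \<open>q'' = \<omega>\<^sup>2 * q - q ^ 3\<close>.\<close>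

definition soliton :: "real \<Rightarrow> real \<Rightarrow> real" where
  "soliton \<omega> y = sqrt 2 * \<omega> * inverse (cosh (\<omega> * y))"

text \<open>Factored through \<open>soliton\<close>, so that the next derivative follows from the
  product rule and the derivative of tanh.\<close>

definition soliton' :: "real \<Rightarrow> real \<Rightarrow> real" where
  "soliton' \<omega> y = - \<omega> * tanh (\<omega> * y) * soliton \<omega> y"

lemma DERIV_soliton: "(soliton \<omega> has_real_derivative soliton' \<omega> y) (at y)"
  unfolding soliton_def[abs_def] soliton'_def
  by (auto intro!: derivative_eq_intros simp: tanh_def divide_inverse)

text \<open>With \<open>tanh\<^sup>2 = 1 - sech\<^sup>2\<close> the derivative becomes
  \<open>\<omega>\<^sup>2 * q * (1 - 2 * sech\<^sup>2)\<close> for the profile q, and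
  \<open>2 * \<omega>\<^sup>2 * sech\<^sup>2\<close> is the square of q; this fixes the factor
  \<open>sqrt 2\<close> in the amplitude.\<close>

lemma DERIV_soliton':
  "(soliton' \<omega> has_real_derivative \<omega>\<^sup>2 * soliton \<omega> y - soliton \<omega> y ^ 3) (at y)"
proof -
  have *: "(1 - (tanh (\<omega> * y))\<^sup>2) = inverse (cosh (\<omega> * y)) ^ 2"
    using cosh_real_nonzero[of "\<omega> * y"]
    by (simp add: tanh_def power_divide divide_simps) (simp add: cosh_square_eq)
  then have t: "(tanh (\<omega> * y))\<^sup>2 = 1 - inverse (cosh (\<omega> * y)) ^ 2"
    by simp
  have "(soliton' \<omega> has_real_derivative
      - \<omega> * (1 - (tanh (\<omega> * y))\<^sup>2) * \<omega> * soliton \<omega> y - \<omega> * tanh (\<omega> * y) * soliton' \<omega> y) (at y)"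
    unfolding soliton'_def[abs_def]
    by (auto intro!: derivative_eq_intros DERIV_soliton simp: soliton'_def algebra_simps)
  also have "- \<omega> * (1 - (tanh (\<omega> * y))\<^sup>2) * \<omega> * soliton \<omega> y - \<omega> * tanh (\<omega> * y) * soliton' \<omega> y
      = \<omega>\<^sup>2 * soliton \<omega> y * (2 * (tanh (\<omega> * y))\<^sup>2 - 1)"
    by (simp add: soliton'_def algebra_simps power2_eq_square)
  also have "\<dots> = \<omega>\<^sup>2 * soliton \<omega> y - soliton \<omega> y * (sqrt 2 * \<omega> * inverse (cosh (\<omega> * y)))\<^sup>2"
    by (simp add: t algebra_simps power_mult_distrib)
  also have "\<dots> = \<omega>\<^sup>2 * soliton \<omega> y - soliton \<omega> y ^ 3"
    by (simp add: soliton_def power2_eq_square power3_eq_cube)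
  finally show ?thesis .
qed

lemma continuous_soliton: "continuous_on A (soliton \<omega>)"
  by (rule DERIV_continuous_on, rule has_field_derivative_at_within[OF DERIV_soliton])

lemma abs_soliton_le: "\<bar>soliton \<omega> y\<bar> \<le> sqrt 2 * \<bar>\<omega>\<bar>"
proof -
  have "inverse (cosh (\<omega> * y)) \<le> 1"
    using cosh_real_ge_1 by (simp add: inverse_le_1_iff)
  then show ?thesis
    by (auto simp: soliton_def abs_mult intro!: mult_left_le)
qed

lemma integrable_soliton:
  assumes "\<omega> > 0"
  shows "integrable lborel (soliton \<omega>)"
  using lborel_integrable_real_affine[OF integrable_sech, of \<omega> 0] assms
  by (simp add: soliton_def[abs_def])

text \<open>The amplitude factor \<omega> cancels the Jacobian of the rescaling: the transform has a
  height independent of \<omega> and spreads over frequencies of size \<omega>, so its squared L2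
  norm grows like \<omega>.\<close>

lemma fourier_soliton:
  assumes "\<omega> > 0"
  shows "(LBINT y. of_real (soliton \<omega> y) * exp (- \<i> * of_real (\<xi> * y))) = sqrt 2 * sech_hat (\<xi> / \<omega>)"
proof -
  have "sech_hat (\<xi> / \<omega>)
      = \<omega> *\<^sub>R (LBINT y. of_real (inverse (cosh (\<omega> * y))) * exp (- \<i> * of_real (\<xi> * y)))"
    unfolding sech_hat_def
    by (subst lborel_integral_real_affine[of \<omega> _ 0]) (use assms in auto)
  then show ?thesis
    by (simp add: soliton_def mult.assoc scaleR_conv_of_real)
qed

section \<open>Sobolev norms of combinations of two solitons on one mode\<close>

text \<open>Free complex coefficients cover everything to be measured: a single solution, its change
  in time, and the difference of two solutions, with coefficients 1 and -1 at time 0 and with equal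
  coefficients at time T.\<close>

lemma sobolev_sq_solitons:
  fixes k :: int
  assumes "\<omega>1 > 0" "\<omega>2 > 0"
  shows "sobolev_sq s (\<lambda>x y. exp (\<i> * of_real (real_of_int k * x)) *
      (c1 * of_real (soliton \<omega>1 y) + c2 * of_real (soliton \<omega>2 y)))
    = (\<integral>\<^sup>+ \<xi>. ennreal ((1 + \<bar>\<xi>\<bar> + \<bar>of_int k\<bar>) powr (2 * s)
        * (2 * (cmod (c1 * sech_hat (\<xi> / \<omega>1) + c2 * sech_hat (\<xi> / \<omega>2)))\<^sup>2)) \<partial>lborel)"
proof -
  have i: "integrable lborel (\<lambda>y. complex_of_real (soliton \<omega>1 y))"
    "integrable lborel (\<lambda>y. complex_of_real (soliton \<omega>2 y))"
    by (intro integrable_of_real integrable_soliton assms)+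
  have "(LBINT y. (c1 * of_real (soliton \<omega>1 y) + c2 * of_real (soliton \<omega>2 y)) * exp (- \<i> * of_real (\<xi> * y)))
      = sqrt 2 * (c1 * sech_hat (\<xi> / \<omega>1) + c2 * sech_hat (\<xi> / \<omega>2))" for \<xi>
  proof -
    have "(LBINT y. (c1 * of_real (soliton \<omega>1 y) + c2 * of_real (soliton \<omega>2 y)) * exp (- \<i> * of_real (\<xi> * y)))
      = (LBINT y. c1 * (of_real (soliton \<omega>1 y) * exp (- \<i> * of_real (\<xi> * y)))
          + c2 * (of_real (soliton \<omega>2 y) * exp (- \<i> * of_real (\<xi> * y))))"
      by (simp add: algebra_simps)
    also have "\<dots> = c1 * (LBINT y. of_real (soliton \<omega>1 y) * exp (- \<i> * of_real (\<xi> * y)))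
        + c2 * (LBINT y. of_real (soliton \<omega>2 y) * exp (- \<i> * of_real (\<xi> * y)))"
      by (subst Bochner_Integration.integral_add)
         (auto intro!: integrable_mult_right simp only: integrable_mult_character[OF i(1)]
           integrable_mult_character[OF i(2)] integral_mult_right_zero)
    finally show ?thesis
      by (simp only: fourier_soliton assms) (simp add: algebra_simps)
  qed
  note eq = this
  show ?thesis
    by (subst sobolev_sq_mode)
       (use i in \<open>auto simp only: eq norm_mult power_mult_distrib
          intro!: Bochner_Integration.integrable_add integrable_mult_right\<close>, simp)
qed

lemma nn_integral_inverse_1_plus_square:
  "(\<integral>\<^sup>+ x. ennreal (inverse (1 + x\<^sup>2)) \<partial>lborel) = ennreal pi"
  using integrable_inverse_1_plus_square LBINT_inverse_1_plus_square
  by (subst nn_integral_eq_integral)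
     (auto simp: set_integrable_def interval_lebesgue_integral_def set_lebesgue_integral_def add_nonneg_nonneg)

text \<open>For \<open>s \<le> 0\<close> the weight is largest when reduced to
  \<open>\<bar>k\<bar>\<close>, and then leaves the integral. Substituting
  \<open>\<xi> = \<omega>1 * \<eta>\<close> normalises the first width, so that only the ratio of
  the widths remains inside.\<close>

lemma sobolev_sq_solitons_le:
  fixes k :: int
  assumes "\<omega>1 > 0" "\<omega>2 > 0" "s \<le> 0" "k \<noteq> 0"
  shows "sobolev_sq s (\<lambda>x y. exp (\<i> * of_real (real_of_int k * x)) *
      (c1 * of_real (soliton \<omega>1 y) + c2 * of_real (soliton \<omega>2 y)))
    \<le> ennreal (2 * \<bar>real_of_int k\<bar> powr (2 * s) * \<omega>1) *
      (\<integral>\<^sup>+ \<eta>. ennreal ((cmod (c1 * sech_hat \<eta> + c2 * sech_hat (\<omega>1 / \<omega>2 * \<eta>)))\<^sup>2) \<partial>lborel)"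
    (is "?l \<le> _")
proof -
  let ?f = "\<lambda>\<xi>. ennreal ((cmod (c1 * sech_hat (\<xi> / \<omega>1) + c2 * sech_hat (\<xi> / \<omega>2)))\<^sup>2)"
  have "?l \<le> (\<integral>\<^sup>+ \<xi>. ennreal (2 * \<bar>real_of_int k\<bar> powr (2 * s)) * ?f \<xi> \<partial>lborel)"
    unfolding sobolev_sq_solitons[OF assms(1,2)]
  proof (rule nn_integral_mono)
    fix \<xi> :: real
    have "(1 + \<bar>\<xi>\<bar> + \<bar>of_int k\<bar>) powr (2 * s) \<le> \<bar>real_of_int k\<bar> powr (2 * s)"
      using assms by (intro powr_mono2') auto
    then show "ennreal ((1 + \<bar>\<xi>\<bar> + \<bar>of_int k\<bar>) powr (2 * s)
          * (2 * (cmod (c1 * sech_hat (\<xi> / \<omega>1) + c2 * sech_hat (\<xi> / \<omega>2)))\<^sup>2))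
        \<le> ennreal (2 * \<bar>real_of_int k\<bar> powr (2 * s)) * ?f \<xi>"
      by (auto simp flip: ennreal_mult'' intro!: ennreal_leI mult_mono)
  qed
  also have "\<dots> = ennreal (2 * \<bar>real_of_int k\<bar> powr (2 * s)) * (\<integral>\<^sup>+ \<xi>. ?f \<xi> \<partial>lborel)"
    by (rule nn_integral_cmult) measurable
  also have "(\<integral>\<^sup>+ \<xi>. ?f \<xi> \<partial>lborel) = ennreal \<omega>1 * (\<integral>\<^sup>+ \<eta>. ?f (0 + \<omega>1 * \<eta>) \<partial>lborel)"
    using assms by (subst nn_integral_real_affine[of _ \<omega>1 0]) auto
  also have "ennreal (2 * \<bar>real_of_int k\<bar> powr (2 * s)) * \<dots>
      = ennreal (2 * \<bar>real_of_int k\<bar> powr (2 * s) * \<omega>1) * (\<integral>\<^sup>+ \<eta>. ?f (0 + \<omega>1 * \<eta>) \<partial>lborel)"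
    using assms by (simp add: ennreal_mult mult.assoc)
  finally show ?thesis
    using assms by (simp add: mult.commute)
qed

text \<open>The constant is \<open>2 * (2 * pi\<^sup>2) * pi\<close>: the squared factor
  \<open>sqrt 2\<close>, the decay bound for \<open>sech_hat\<close> and the integral of
  \<open>1 / (1 + \<eta>\<^sup>2)\<close>. The dependence on c is kept because c will be a
  difference of phases when continuity in time is shown.\<close>

lemma sobolev_sq_soliton_le:
  fixes k :: int
  assumes "\<omega> > 0" "s \<le> 0" "k \<noteq> 0"
  shows "sobolev_sq s (\<lambda>x y. exp (\<i> * of_real (real_of_int k * x)) * (c * of_real (soliton \<omega> y)))
    \<le> ennreal (4 * pi ^ 3 * (cmod c)\<^sup>2 * (\<bar>real_of_int k\<bar> powr (2 * s) * \<omega>))"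
proof -
  have "(\<integral>\<^sup>+ \<eta>. ennreal ((cmod (c * sech_hat \<eta>))\<^sup>2) \<partial>lborel)
      \<le> (\<integral>\<^sup>+ \<eta>. ennreal ((cmod c)\<^sup>2 * (2 * pi\<^sup>2)) * ennreal (inverse (1 + \<eta>\<^sup>2)) \<partial>lborel)"
    by (intro nn_integral_mono)
       (auto simp: norm_mult power_mult_distrib mult.assoc simp flip: ennreal_mult'
        intro!: ennreal_leI mult_left_mono norm_sech_hat_sq_le[simplified mult.assoc])
  also have "\<dots> = ennreal ((cmod c)\<^sup>2 * (2 * pi\<^sup>2)) * ennreal pi"
    by (subst nn_integral_cmult) (simp_all add: nn_integral_inverse_1_plus_square)
  also have "\<dots> = ennreal ((cmod c)\<^sup>2 * (2 * pi ^ 3))"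
    by (simp add: power2_eq_square power3_eq_cube mult_ac flip: ennreal_mult)
  finally have *: "(\<integral>\<^sup>+ \<eta>. ennreal ((cmod (c * sech_hat \<eta>))\<^sup>2) \<partial>lborel)
      \<le> ennreal ((cmod c)\<^sup>2 * (2 * pi ^ 3))" .
  have "sobolev_sq s (\<lambda>x y. exp (\<i> * of_real (real_of_int k * x)) * (c * of_real (soliton \<omega> y)))
      \<le> ennreal (2 * \<bar>real_of_int k\<bar> powr (2 * s) * \<omega>) *
        (\<integral>\<^sup>+ \<eta>. ennreal ((cmod (c * sech_hat \<eta>))\<^sup>2) \<partial>lborel)"
    using sobolev_sq_solitons_le[of \<omega> \<omega> s k c 0] assms by simp
  also have "\<dots> \<le> ennreal (2 * \<bar>real_of_int k\<bar> powr (2 * s) * \<omega>) * ennreal ((cmod c)\<^sup>2 * (2 * pi ^ 3))"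
    by (intro mult_left_mono *) simp
  also have "\<dots> = ennreal (4 * pi ^ 3 * (cmod c)\<^sup>2 * (\<bar>real_of_int k\<bar> powr (2 * s) * \<omega>))"
    using assms by (simp add: mult_ac flip: ennreal_mult)
  finally show ?thesis .
qed

text \<open>By \<open>\<bar>a + b\<bar>\<^sup>2 \<le> 2 * \<bar>a\<bar>\<^sup>2 + 2 *
  \<bar>b\<bar>\<^sup>2\<close> the claim reduces to single solitons. It lets the lower bound at
  time T pass from the extended squared norm to the real norm.\<close>

lemma sobolev_sq_solitons_finite:
  fixes k :: int
  assumes "\<omega>1 > 0" "\<omega>2 > 0" "s \<le> 0" "k \<noteq> 0"
  shows "sobolev_sq s (\<lambda>x y. exp (\<i> * of_real (real_of_int k * x)) *
      (c1 * of_real (soliton \<omega>1 y) + c2 * of_real (soliton \<omega>2 y))) < \<infinity>"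
proof -
  let ?W = "\<lambda>\<xi>. (1 + \<bar>\<xi>\<bar> + \<bar>of_int k\<bar>) powr (2 * s)"
  let ?f = "\<lambda>c \<omega> \<xi>. ennreal (?W \<xi> * (2 * (cmod (c * sech_hat (\<xi> / \<omega>)))\<^sup>2))"
  have fin: "(\<integral>\<^sup>+ \<xi>. ?f c \<omega> \<xi> \<partial>lborel) < \<infinity>" if "\<omega> > 0" for c \<omega>
    using sobolev_sq_solitons[OF that that, of s k c 0] sobolev_sq_soliton_le[OF that assms(3,4), of c]
    by (auto intro: le_less_trans)
  have "?W \<xi> * (2 * (cmod (c1 * sech_hat (\<xi> / \<omega>1) + c2 * sech_hat (\<xi> / \<omega>2)))\<^sup>2)
      \<le> 2 * (?W \<xi> * (2 * (cmod (c1 * sech_hat (\<xi> / \<omega>1)))\<^sup>2))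
        + 2 * (?W \<xi> * (2 * (cmod (c2 * sech_hat (\<xi> / \<omega>2)))\<^sup>2))" for \<xi>
  proof -
    let ?a = "c1 * sech_hat (\<xi> / \<omega>1)" and ?b = "c2 * sech_hat (\<xi> / \<omega>2)"
    have "(cmod (?a + ?b))\<^sup>2 \<le> (cmod ?a + cmod ?b)\<^sup>2"
      by (intro power_mono norm_triangle_ineq) simp
    also have "\<dots> \<le> 2 * (cmod ?a)\<^sup>2 + 2 * (cmod ?b)\<^sup>2"
      using sum_squares_bound[of "cmod ?a" "cmod ?b"] by (simp add: power2_sum)
    finally have "(2 * ?W \<xi>) * (cmod (?a + ?b))\<^sup>2
        \<le> (2 * ?W \<xi>) * (2 * (cmod ?a)\<^sup>2 + 2 * (cmod ?b)\<^sup>2)"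
      by (intro mult_left_mono) auto
    then show ?thesis
      by (simp add: algebra_simps)
  qed
  then have "(\<integral>\<^sup>+ \<xi>. ennreal (?W \<xi> * (2 * (cmod (c1 * sech_hat (\<xi> / \<omega>1) + c2 * sech_hat (\<xi> / \<omega>2)))\<^sup>2)) \<partial>lborel)
      \<le> (\<integral>\<^sup>+ \<xi>. 2 * ?f c1 \<omega>1 \<xi> + 2 * ?f c2 \<omega>2 \<xi> \<partial>lborel)"
    by (intro nn_integral_mono)
       (simp flip: ennreal_plus ennreal_mult' ennreal_numeral add: ennreal_leI)
  also have "\<dots> = 2 * (\<integral>\<^sup>+ \<xi>. ?f c1 \<omega>1 \<xi> \<partial>lborel) + 2 * (\<integral>\<^sup>+ \<xi>. ?f c2 \<omega>2 \<xi> \<partial>lborel)"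
    by (subst nn_integral_add; simp add: nn_integral_cmult)
  also have "\<dots> < \<infinity>"
    using fin assms by (simp add: ennreal_mult_less_top)
  finally show ?thesis
    by (simp only: sobolev_sq_solitons assms)
qed

text \<open>Near frequency 0 both transforms are close to pi and add without cancellation, on an
  interval of length proportional to \<open>\<omega>1\<close>. There the weight is comparable to
  that of k because \<open>\<omega>1 \<le> \<bar>k\<bar>\<close>. The constant d depends on
  \<open>sech_hat\<close> only, hence the bound is uniform in the mode and the widths.\<close>

lemma sobolev_sq_twice_soliton_ge:
  obtains d where "d > 0"
    and "\<And>(k :: int) s \<omega>1 \<omega>2 c. \<lbrakk>s \<le> 0; 0 < \<omega>1; \<omega>1 \<le> \<omega>2; k \<noteq> (0::int); \<omega>1 \<le> \<bar>real_of_int k\<bar>; cmod c = 1\<rbrakk> \<Longrightarrow>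
      ennreal (d * (2 + d) powr (2 * s) * (\<bar>real_of_int k\<bar> powr (2 * s) * \<omega>1))
        \<le> sobolev_sq s (\<lambda>x y. exp (\<i> * of_real (real_of_int k * x)) *
            (c * of_real (soliton \<omega>1 y) + c * of_real (soliton \<omega>2 y)))"
proof -
  \<comment> \<open>The tolerance 2 works because \<open>sech_hat 0\<close> is pi, which exceeds 3:
    the real part then stays above 1.\<close>
  have "eventually (\<lambda>\<eta>. dist (sech_hat \<eta>) (sech_hat 0) < 2) (nhds 0)"
    using isCont_sech_hat[of 0] unfolding isCont_def
    by (intro tendstoD) (auto simp: tendsto_at_iff_tendsto_nhds)
  then obtain d0 where "d0 > 0" and d0: "\<And>\<eta>. \<bar>\<eta>\<bar> < d0 \<Longrightarrow> dist (sech_hat \<eta>) (sech_hat 0) < 2"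
    unfolding eventually_nhds_metric by (auto simp: dist_norm)
  define d where "d = d0 / 2"
  have "d > 0"
    using \<open>d0 > 0\<close> by (simp add: d_def)
  have Re: "Re (sech_hat \<eta>) \<ge> 1" if "\<bar>\<eta>\<bar> \<le> d" for \<eta>
  proof -
    have "\<bar>Re (sech_hat \<eta> - sech_hat 0)\<bar> < 2"
      using d0[of \<eta>] that \<open>d0 > 0\<close> abs_Re_le_cmod[of "sech_hat \<eta> - sech_hat 0"]
      by (simp add: dist_norm d_def)
    then show ?thesis
      using pi_gt3 by (simp add: sech_hat_0)
  qed
  show thesis
  proof (rule that[OF \<open>d > 0\<close>])
    fix k :: int and s \<omega>1 \<omega>2 :: real and c :: complex
    assume a: "s \<le> 0" "0 < \<omega>1" "\<omega>1 \<le> \<omega>2" "k \<noteq> 0" "\<omega>1 \<le> \<bar>real_of_int k\<bar>" "cmod c = 1"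
    let ?K = "\<bar>of_int k\<bar> :: real"
    have K: "?K \<ge> 1"
      using a by linarith
    \<comment> \<open>On \<open>\<bar>\<xi>\<bar> \<le> d * \<omega>1\<close> the base of the weight
      is at most \<open>(2 + d) * \<bar>k\<bar>\<close>, and the nonpositive exponent reverses this
      inequality. The interval has length \<open>2 * d * \<omega>1\<close>; the factor 2 is given
      away.\<close>
    have "ennreal (d * (2 + d) powr (2 * s) * (\<bar>real_of_int k\<bar> powr (2 * s) * \<omega>1))
        \<le> ennreal (((2 + d) * ?K) powr (2 * s)) * ennreal (2 * (d * \<omega>1))"
      using \<open>d > 0\<close> a by (auto simp: powr_mult mult_ac simp flip: ennreal_mult intro!: ennreal_leI)
    also have "\<dots> = (\<integral>\<^sup>+ \<xi>. ennreal (((2 + d) * ?K) powr (2 * s)) * indicator {- (d * \<omega>1)..d * \<omega>1} \<xi> \<partial>lborel)"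
      using \<open>d > 0\<close> a by (subst nn_integral_cmult) (auto simp: mult_ac)
    also have "\<dots> \<le> (\<integral>\<^sup>+ \<xi>. ennreal ((1 + \<bar>\<xi>\<bar> + \<bar>of_int k\<bar>) powr (2 * s)
        * (2 * (cmod (c * sech_hat (\<xi> / \<omega>1) + c * sech_hat (\<xi> / \<omega>2)))\<^sup>2)) \<partial>lborel)"
    proof (rule nn_integral_mono)
      fix \<xi> :: real
      show "ennreal (((2 + d) * ?K) powr (2 * s)) * indicator {- (d * \<omega>1)..d * \<omega>1} \<xi>
        \<le> ennreal ((1 + \<bar>\<xi>\<bar> + \<bar>of_int k\<bar>) powr (2 * s)
        * (2 * (cmod (c * sech_hat (\<xi> / \<omega>1) + c * sech_hat (\<xi> / \<omega>2)))\<^sup>2))"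
      proof (cases "\<xi> \<in> {- (d * \<omega>1)..d * \<omega>1}")
        case True
        then have \<xi>: "\<bar>\<xi>\<bar> \<le> d * \<omega>1"
          by auto
        also have "\<dots> \<le> d * \<omega>2"
          using a \<open>d > 0\<close> by simp
        finally have \<xi>2: "\<bar>\<xi>\<bar> \<le> d * \<omega>2" .
        have "2 \<le> Re (sech_hat (\<xi> / \<omega>1) + sech_hat (\<xi> / \<omega>2))"
          using Re[of "\<xi> / \<omega>1"] Re[of "\<xi> / \<omega>2"] \<xi> \<xi>2 a by (simp add: field_simps)
        also have "\<dots> \<le> cmod (sech_hat (\<xi> / \<omega>1) + sech_hat (\<xi> / \<omega>2))"
          by (rule complex_Re_le_cmod)
        also have "\<dots> = cmod (c * sech_hat (\<xi> / \<omega>1) + c * sech_hat (\<xi> / \<omega>2))"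
          using a by (simp add: norm_mult flip: distrib_left)
        finally have n: "2 \<le> cmod (c * sech_hat (\<xi> / \<omega>1) + c * sech_hat (\<xi> / \<omega>2))" .
        have "1 * 1 \<le> cmod (c * sech_hat (\<xi> / \<omega>1) + c * sech_hat (\<xi> / \<omega>2))
            * cmod (c * sech_hat (\<xi> / \<omega>1) + c * sech_hat (\<xi> / \<omega>2))"
          using n by (intro mult_mono) auto
        then have n: "1 \<le> 2 * (cmod (c * sech_hat (\<xi> / \<omega>1) + c * sech_hat (\<xi> / \<omega>2)))\<^sup>2"
          by (simp add: power2_eq_square)
        have "d * \<omega>1 \<le> d * ?K"
          using a \<open>d > 0\<close> by simp
        then have "1 + \<bar>\<xi>\<bar> + ?K \<le> (2 + d) * ?K"
          using \<xi> K by (simp add: algebra_simps)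
        then have "((2 + d) * ?K) powr (2 * s) \<le> (1 + \<bar>\<xi>\<bar> + ?K) powr (2 * s)"
          using a by (intro powr_mono2') auto
        then show ?thesis
          using True mult_mono[OF _ n] by (fastforce intro!: ennreal_leI)
      qed simp
    qed
    also have "\<dots> = sobolev_sq s (\<lambda>x y. exp (\<i> * of_real (real_of_int k * x)) *
            (c * of_real (soliton \<omega>1 y) + c * of_real (soliton \<omega>2 y)))"
      using a by (subst sobolev_sq_solitons) auto
    finally show "ennreal (d * (2 + d) powr (2 * s) * (\<bar>real_of_int k\<bar> powr (2 * s) * \<omega>1))
        \<le> sobolev_sq s (\<lambda>x y. exp (\<i> * of_real (real_of_int k * x)) *
            (c * of_real (soliton \<omega>1 y) + c * of_real (soliton \<omega>2 y)))" .
  qed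
qed

text \<open>Dominated convergence: pointwise convergence is continuity of \<open>sech_hat\<close>,
  and the lower bound \<open>r0\<close> on the dilations provides one majorant for all n. It is
  applied to the ratio of the two widths at time 0.\<close>

lemma sech_hat_dilation_tendsto_L2:
  assumes r: "r \<longlonglongrightarrow> 1" and r0: "r0 > 0" "\<And>n. r0 \<le> r n" "\<And>n. r n \<le> 1"
  shows "(\<lambda>n::nat. \<integral>\<^sup>+ \<eta>. ennreal ((cmod (sech_hat \<eta> - sech_hat (r n * \<eta>)))\<^sup>2) \<partial>lborel) \<longlonglongrightarrow> 0"
proof -
  define C where "C = 4 * pi\<^sup>2 + 4 * pi\<^sup>2 / r0\<^sup>2"
  have "C \<ge> 0"
    by (simp add: C_def)
  have bound: "(cmod (sech_hat \<eta> - sech_hat (r n * \<eta>)))\<^sup>2 \<le> C * inverse (1 + \<eta>\<^sup>2)" for n \<eta>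
  proof -
    let ?a = "cmod (sech_hat \<eta>)" and ?b = "cmod (sech_hat (r n * \<eta>))"
    have pos: "r n > 0"
      using r0(1) r0(2)[of n] by linarith
    have "(cmod (sech_hat \<eta> - sech_hat (r n * \<eta>)))\<^sup>2 \<le> (?a + ?b)\<^sup>2"
      by (intro power_mono norm_triangle_ineq4) simp
    also have "\<dots> \<le> 2 * ?a\<^sup>2 + 2 * ?b\<^sup>2"
      using sum_squares_bound[of ?a ?b] by (simp add: power2_sum)
    also have "\<dots> \<le> 2 * (2 * pi\<^sup>2 * inverse (1 + \<eta>\<^sup>2)) + 2 * (2 * pi\<^sup>2 * inverse (1 + (r n * \<eta>)\<^sup>2))"
      by (intro add_mono mult_left_mono norm_sech_hat_sq_le) auto
    \<comment> \<open>Since \<open>r0 \<le> r n \<le> 1\<close>, the square of \<open>r0\<close> is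
      below both 1 and the square of \<open>r n\<close>, so the dilated denominator is at least
      \<open>r0\<^sup>2 * (1 + \<eta>\<^sup>2)\<close>.\<close>
    also have "inverse (1 + (r n * \<eta>)\<^sup>2) \<le> inverse (r0\<^sup>2 * (1 + \<eta>\<^sup>2))"
    proof (rule le_imp_inverse_le)
      have "r0\<^sup>2 \<le> 1\<^sup>2" "r0\<^sup>2 \<le> (r n)\<^sup>2"
        using r0(1) r0(2)[of n] r0(3)[of n] by (intro power_mono; linarith)+
      then have "r0\<^sup>2 \<le> 1" "r0\<^sup>2 * \<eta>\<^sup>2 \<le> (r n)\<^sup>2 * \<eta>\<^sup>2"
        by (auto intro: mult_right_mono)
      then show "r0\<^sup>2 * (1 + \<eta>\<^sup>2) \<le> 1 + (r n * \<eta>)\<^sup>2"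
        by (simp add: power_mult_distrib algebra_simps)
    qed (use r0 in \<open>auto intro!: mult_pos_pos add_pos_nonneg\<close>)
    finally show ?thesis
      unfolding C_def by (simp only: inverse_mult_distrib) (simp add: algebra_simps divide_inverse)
  qed
  have "(\<lambda>n. \<integral>\<^sup>+ \<eta>. ennreal ((cmod (sech_hat \<eta> - sech_hat (r n * \<eta>)))\<^sup>2) \<partial>lborel)
      \<longlonglongrightarrow> (\<integral>\<^sup>+ \<eta>. 0 \<partial>(lborel :: real measure))"
  proof (rule nn_integral_dominated_convergence[where w = "\<lambda>\<eta>. ennreal C * ennreal (inverse (1 + \<eta>\<^sup>2))"])
    show "(\<integral>\<^sup>+ \<eta>. ennreal C * ennreal (inverse (1 + \<eta>\<^sup>2)) \<partial>lborel) < \<infinity>"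
      by (subst nn_integral_cmult)
         (simp_all add: nn_integral_inverse_1_plus_square ennreal_mult_less_top)
    show "AE \<eta> in lborel. (\<lambda>n. ennreal ((cmod (sech_hat \<eta> - sech_hat (r n * \<eta>)))\<^sup>2)) \<longlonglongrightarrow> 0"
    proof (rule AE_I2)
      fix \<eta> :: real
      have "(\<lambda>n. r n * \<eta>) \<longlonglongrightarrow> 1 * \<eta>"
        by (intro tendsto_intros r)
      then have "(\<lambda>n. sech_hat (r n * \<eta>)) \<longlonglongrightarrow> sech_hat \<eta>"
        using isCont_tendsto_compose[OF isCont_sech_hat] by fastforce
      then have "(\<lambda>n. ennreal ((cmod (sech_hat \<eta> - sech_hat (r n * \<eta>)))\<^sup>2))
          \<longlonglongrightarrow> ennreal ((cmod (sech_hat \<eta> - sech_hat \<eta>))\<^sup>2)"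
        by (intro tendsto_intros tendsto_ennrealI)
      then show "(\<lambda>n. ennreal ((cmod (sech_hat \<eta> - sech_hat (r n * \<eta>)))\<^sup>2)) \<longlonglongrightarrow> 0"
        by simp
    qed
    show "AE \<eta> in lborel. ennreal ((cmod (sech_hat \<eta> - sech_hat (r n * \<eta>)))\<^sup>2)
        \<le> ennreal C * ennreal (inverse (1 + \<eta>\<^sup>2))" for n
      using bound \<open>C \<ge> 0\<close> by (auto simp flip: ennreal_mult' intro!: ennreal_leI)
  qed measurable
  then show ?thesis
    by simp
qed

section \<open>Waves oscillating in t and x: derivatives, regularity and the equation\<close>

text \<open>The profile is a parameter because differentiation in y gives a wave again, with p
  replaced by its derivative.\<close>

definition wave :: "int \<Rightarrow> real \<Rightarrow> (real \<Rightarrow> real) \<Rightarrow> real \<Rightarrow> real \<Rightarrow> real \<Rightarrow> complex" where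
  "wave k \<mu> p t x y = exp (\<i> * of_real (real_of_int k * x)) * (exp (\<i> * of_real (\<mu> * t)) * of_real (p y))"

lemma norm_wave: "cmod (wave k \<mu> p t x y) = \<bar>p y\<bar>"
  by (simp add: wave_def norm_mult)

lemma wave_has_Dt:
  "((\<lambda>\<tau>. wave k \<mu> p \<tau> x y) has_vector_derivative \<i> * of_real \<mu> * wave k \<mu> p t x y) (at t)"
proof -
  have "((\<lambda>z. exp (\<i> * of_real (real_of_int k * x)) * (exp (\<i> * (of_real \<mu> * z)) * of_real (p y))) has_field_derivative
      \<i> * of_real \<mu> * (exp (\<i> * of_real (real_of_int k * x)) * (exp (\<i> * (of_real \<mu> * of_real t)) * of_real (p y))))
      (at (of_real t))"
    by (auto intro!: derivative_eq_intros)
  from has_vector_derivative_real_field[OF this] show ?thesis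
    by (simp add: wave_def[abs_def])
qed

text \<open>The prefactor c makes the rule applicable to its own result, as the induction over
  iterated x-derivatives requires.\<close>

lemma wave_has_Dx:
  "((\<lambda>\<xi>. c * wave k \<mu> p t \<xi> y) has_vector_derivative c * (\<i> * of_int k) * wave k \<mu> p t x y) (at x)"
proof -
  have "((\<lambda>z. c * (exp (\<i> * (of_int k * z)) * (exp (\<i> * of_real (\<mu> * t)) * of_real (p y)))) has_field_derivative
      c * (\<i> * of_int k) * (exp (\<i> * (of_int k * of_real x)) * (exp (\<i> * of_real (\<mu> * t)) * of_real (p y))))
      (at (of_real x))"
    by (auto intro!: derivative_eq_intros)
  from has_vector_derivative_real_field[OF this] show ?thesis
    by (simp add: wave_def[abs_def])
qed

lemma wave_has_Dy:
  assumes "(p has_real_derivative p' y) (at y)"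
  shows "((\<lambda>\<eta>. wave k \<mu> p t x \<eta>) has_vector_derivative wave k \<mu> p' t x y) (at y)"
proof -
  have "((\<lambda>\<eta>. of_real (p \<eta>)) has_vector_derivative complex_of_real (p' y)) (at y)"
    using assms by (intro bounded_linear.has_vector_derivative[OF bounded_linear_of_real])
      (simp add: has_real_derivative_iff_has_vector_derivative)
  then show ?thesis
    unfolding wave_def[abs_def]
    by (intro bounded_linear.has_vector_derivative[OF bounded_linear_mult_right])
qed

lemma Dt_wave: "Dt (wave k \<mu> p) = (\<lambda>t x y. \<i> * of_real \<mu> * wave k \<mu> p t x y)"
  unfolding Dt_def by (intro ext vector_derivative_at wave_has_Dt)

lemma Dx_power_wave: "(Dx ^^ j) (wave k \<mu> p) = (\<lambda>t x y. (\<i> * of_int k) ^ j * wave k \<mu> p t x y)"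
proof (induction j)
  case (Suc j)
  have "Dx (\<lambda>t x y. (\<i> * of_int k) ^ j * wave k \<mu> p t x y)
      = (\<lambda>t x y. (\<i> * of_int k) ^ j * (\<i> * of_int k) * wave k \<mu> p t x y)"
    unfolding Dx_def by (intro ext vector_derivative_at wave_has_Dx)
  with Suc show ?case
    by (simp add: mult.commute)
qed simp

lemma Dy_wave:
  assumes "\<And>y. (p has_real_derivative p' y) (at y)"
  shows "Dy (wave k \<mu> p) = wave k \<mu> p'"
  unfolding Dy_def by (intro ext vector_derivative_at wave_has_Dy assms)

lemma jointly_continuous_wave:
  assumes "continuous_on UNIV p"
  shows "jointly_continuous (\<lambda>t x y. c * wave k \<mu> p t x y)"
proof -
  have "continuous_on UNIV (\<lambda>z::real \<times> real \<times> real. p (snd (snd z)))"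
    by (rule continuous_on_compose2[OF assms]) (auto intro!: continuous_intros)
  then show ?thesis
    unfolding jointly_continuous_def wave_def case_prod_beta by (intro continuous_intros)
qed

lemma classically_regular_wave:
  assumes p: "\<And>y. (p has_real_derivative p' y) (at y)"
    and p': "\<And>y. (p' has_real_derivative p'' y) (at y)"
    and p'': "continuous_on UNIV p''"
  shows "classically_regular (wave k \<mu> p)"
proof -
  have Dy: "(Dy ^^ 0) (wave k \<mu> p) = wave k \<mu> p" "(Dy ^^ 1) (wave k \<mu> p) = wave k \<mu> p'"
    "(Dy ^^ 2) (wave k \<mu> p) = wave k \<mu> p''"
    by (simp_all add: numeral_2_eq_2 Dy_wave[OF p] Dy_wave[OF p'])
  have cont: "continuous_on UNIV p" "continuous_on UNIV p'"
    by (rule DERIV_continuous_on, rule has_field_derivative_at_within, rule p p')+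
  have le2: "j = 0 \<or> j = 1 \<or> j = 2" if "j \<le> 2" for j :: nat
    using that by linarith
  have diff_y: "(\<lambda>\<eta>. (Dy ^^ j) (wave k \<mu> p) t x \<eta>) differentiable (at y)" if "j < 2" for j t x y
    using le2[of j] that Dy differentiableI_vector[OF wave_has_Dy[of p p', OF p]]
      differentiableI_vector[OF wave_has_Dy[of p' p'', OF p']]
    by fastforce
  have jc_y: "jointly_continuous ((Dy ^^ j) (wave k \<mu> p))" if "j \<le> 2" for j
    using le2[OF that] Dy jointly_continuous_wave[OF cont(1), of 1] jointly_continuous_wave[OF cont(2), of 1]
      jointly_continuous_wave[OF p'', of 1]
    by auto
  show ?thesis
    unfolding classically_regular_def Dt_wave Dx_power_wave
    by (intro conjI allI impI differentiableI_vector[OF wave_has_Dt] differentiableI_vector[OF wave_has_Dx]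
        jointly_continuous_wave cont diff_y jc_y)
qed

lemma periodic_wave: "periodic_x (wave k \<mu> p t)"
proof -
  have "exp (\<i> * complex_of_real (k * (x + 2 * pi))) = exp (\<i> * complex_of_real (real_of_int k * x))" for x :: real
  proof -
    have "exp (\<i> * complex_of_real (k * (x + 2 * pi)))
        = exp (\<i> * complex_of_real (real_of_int k * x)) * exp ((2 * of_int k * pi) * \<i>)"
      unfolding exp_add[symmetric] by (simp add: algebra_simps)
    also have "exp ((2 * of_int k * pi) * \<i>) = 1"
      using exp_integer_2pi[of "of_int k"] by simp
    finally show ?thesis
      by simp
  qed
  then show ?thesis
    by (simp add: periodic_x_def wave_def)
qed

lemma integrable_TR_wave:
  assumes "integrable lborel p"
  shows "integrable_TR (wave k \<mu> p t)"
  unfolding integrable_TR_def wave_def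
  by (intro mode_integrable_integral(1) integrable_mult_right integrable_of_real assms)

text \<open>The modulus of a wave is independent of t and x, so one bound serves all time intervals;
  the maximum covers the L1 and the sup bound at once.\<close>

lemma locally_bounded_wave:
  assumes "integrable lborel p" and "\<And>y. \<bar>p y\<bar> \<le> C"
  shows "locally_bounded_L1_Linf (wave k \<mu> p)"
  unfolding locally_bounded_L1_Linf_def norm_wave
proof (intro allI exI ballI conjI)
  fix R t x y :: real
  let ?L = "LINT (x, y):period_strip|lborel. \<bar>p y\<bar>"
  show "integrable_TR (wave k \<mu> p t)"
    by (rule integrable_TR_wave) (fact assms)
  show "?L \<le> max ?L C" "\<bar>p y\<bar> \<le> max ?L C"
    using assms(2)[of y] by auto
qed

text \<open>The derivatives in t and x act as the scalars \<open>- \<mu>\<close>,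
  \<open>- \<epsilon> * k\<^sup>2\<close> and \<open>\<alpha> * k ^ 4\<close>, and the profile
  equation contributes \<open>\<omega>\<^sup>2\<close>. The dispersion relation for \<mu> makes
  these cancel, and the cubic term of the profile equation is the nonlinearity.\<close>

lemma solves_ivp_soliton:
  assumes "\<omega> > 0" and \<mu>: "\<mu> = \<omega>\<^sup>2 - \<epsilon> * (of_int k)\<^sup>2 + \<alpha> * of_int k ^ 4"
  shows "solves_ivp \<epsilon> \<alpha> (wave k \<mu> (soliton \<omega>) 0) (wave k \<mu> (soliton \<omega>))"
proof -
  have Dy: "(Dy ^^ 2) (wave k \<mu> (soliton \<omega>)) = wave k \<mu> (\<lambda>y. \<omega>\<^sup>2 * soliton \<omega> y - soliton \<omega> y ^ 3)"
    using Dy_wave[of "soliton \<omega>" "soliton' \<omega>"] Dy_wave[of "soliton' \<omega>"] DERIV_soliton DERIV_soliton'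
    by (simp add: numeral_2_eq_2)
  have eq: "\<i> * (\<i> * of_real \<mu> * wave k \<mu> (soliton \<omega>) t x y)
      + of_real \<epsilon> * ((\<i> * of_int k)\<^sup>2 * wave k \<mu> (soliton \<omega>) t x y)
      + wave k \<mu> (\<lambda>y. \<omega>\<^sup>2 * soliton \<omega> y - soliton \<omega> y ^ 3) t x y
      + of_real \<alpha> * ((\<i> * of_int k) ^ 4 * wave k \<mu> (soliton \<omega>) t x y)
      = - (of_real (\<bar>soliton \<omega> y\<bar>\<^sup>2) * wave k \<mu> (soliton \<omega>) t x y)" for t x y
  proof -
    define w where "w = exp (\<i> * of_real (real_of_int k * x)) * exp (\<i> * of_real (\<mu> * t))"
    have w: "wave k \<mu> p t x y = w * of_real (p y)" for p
      by (simp add: wave_def w_def)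
    have i4: "(\<i> * complex_of_int k) ^ 4 = of_int k ^ 4" "(\<i> * complex_of_int k) ^ 2 = - (of_int k ^ 2)"
      by (simp_all add: power_mult_distrib)
    show ?thesis
      unfolding w i4 by (simp add: \<mu> algebra_simps power2_eq_square power3_eq_cube)
  qed
  show ?thesis
    unfolding solves_ivp_def Dt_wave Dx_power_wave Dy norm_wave
    using eq
    by (auto intro!: periodic_wave locally_bounded_wave integrable_soliton abs_soliton_le assms
        classically_regular_wave[OF DERIV_soliton DERIV_soliton'] continuous_intros continuous_soliton)
qed

section \<open>Real-valued norms, and solitons as data-solution pairs\<close>

lemma sobolev_norm_le:
  assumes "sobolev_sq s f \<le> ennreal b" "b \<ge> 0"
  shows "sobolev_norm s f \<le> sqrt b"
  unfolding sobolev_norm_def using enn2real_leI[OF assms(2,1)] by simp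

text \<open>Finiteness guards against \<open>enn2real\<close> sending infinity to 0, which would
  destroy a lower bound.\<close>

lemma sobolev_norm_ge:
  assumes "ennreal b \<le> sobolev_sq s f" "b \<ge> 0" "sobolev_sq s f < \<infinity>"
  shows "sqrt b \<le> sobolev_norm s f"
  unfolding sobolev_norm_def using enn2real_mono[OF assms(1)] assms(2,3) by simp

text \<open>Between two times the solution changes only by its phase, so the difference is the same
  soliton mode multiplied by a difference of phases. Its norm is bounded by a constant times the
  modulus of that difference, which gives continuity in time.\<close>

lemma data_solution_soliton:
  fixes k :: int
  assumes "\<omega> > 0" and \<mu>: "\<mu> = \<omega>\<^sup>2 - \<epsilon> * (of_int k)\<^sup>2 + \<alpha> * of_int k ^ 4"
    and "s \<le> 0" "k \<noteq> 0"
  shows "data_solution \<epsilon> \<alpha> s T (wave k \<mu> (soliton \<omega>) 0) (wave k \<mu> (soliton \<omega>))"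
proof -
  let ?u = "wave k \<mu> (soliton \<omega>)"
  let ?e = "\<lambda>t. exp (\<i> * complex_of_real (\<mu> * t))"
  define C where "C = \<bar>real_of_int k\<bar> powr (2 * s) * \<omega>"
  have "C \<ge> 0"
    using assms by (simp add: C_def)
  note le = sobolev_sq_soliton_le[OF assms(1,3,4), folded C_def]
  have "in_sobolev s (?u t)" for t
  proof -
    have "sobolev_sq s (?u t) < \<infinity>"
      using le[of "?e t"] by (auto simp: wave_def[abs_def] intro: le_less_trans)
    then show ?thesis
      by (simp add: in_sobolev_def integrable_TR_wave periodic_wave integrable_soliton assms)
  qed
  moreover have "((\<lambda>\<tau>. sobolev_dist s (?u \<tau>) (?u t)) \<longlongrightarrow> 0) (at t within {0..T})" for t
  proof (rule tendsto_sandwich)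
    show "\<forall>\<^sub>F \<tau> in at t within {0..T}. 0 \<le> sobolev_dist s (?u \<tau>) (?u t)"
      by (simp add: sobolev_dist_def sobolev_norm_def)
    have "sobolev_dist s (?u \<tau>) (?u t) \<le> sqrt (4 * pi ^ 3 * (cmod (?e \<tau> - ?e t))\<^sup>2 * C)" for \<tau>
      unfolding sobolev_dist_def
    proof (rule sobolev_norm_le)
      have "(\<lambda>x y. ?u \<tau> x y - ?u t x y)
          = (\<lambda>x y. exp (\<i> * of_real (real_of_int k * x)) * ((?e \<tau> - ?e t) * of_real (soliton \<omega> y)))"
        by (simp add: wave_def algebra_simps)
      then show "sobolev_sq s (\<lambda>x y. ?u \<tau> x y - ?u t x y) \<le> ennreal (4 * pi ^ 3 * (cmod (?e \<tau> - ?e t))\<^sup>2 * C)"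
        using le by simp
    qed (use \<open>C \<ge> 0\<close> in simp)
    then show "\<forall>\<^sub>F \<tau> in at t within {0..T}.
        sobolev_dist s (?u \<tau>) (?u t) \<le> sqrt (4 * pi ^ 3 * (cmod (?e \<tau> - ?e t))\<^sup>2 * C)"
      by simp
    have "((\<lambda>\<tau>. sqrt (4 * pi ^ 3 * (cmod (?e \<tau> - ?e t))\<^sup>2 * C))
        \<longlongrightarrow> sqrt (4 * pi ^ 3 * (cmod (?e t - ?e t))\<^sup>2 * C)) (at t within {0..T})"
      by (intro tendsto_intros)
    then show "((\<lambda>\<tau>. sqrt (4 * pi ^ 3 * (cmod (?e \<tau> - ?e t))\<^sup>2 * C)) \<longlongrightarrow> 0) (at t within {0..T})"
      by simp
  qed simp
  ultimately show ?thesis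
    using solves_ivp_soliton[OF assms(1,2)]
    by (simp add: data_solution_def continuous_into_sobolev_def)
qed

section \<open>The two sequences and the failure of uniform continuity\<close>

theorem theorem2p4:
  fixes \<alpha> \<epsilon> s T :: real
  assumes "\<alpha> < 0"
    and "\<epsilon> \<in> {0, 1}"
    and "- (1 / 2) \<le> s" and "s < 0"
    and "T > 0"
  shows "\<exists>(\<phi> :: nat \<Rightarrow> real \<Rightarrow> real \<Rightarrow> complex) (\<psi> :: nat \<Rightarrow> real \<Rightarrow> real \<Rightarrow> complex)
           (u :: nat \<Rightarrow> real \<Rightarrow> real \<Rightarrow> real \<Rightarrow> complex) (v :: nat \<Rightarrow> real \<Rightarrow> real \<Rightarrow> real \<Rightarrow> complex).
           (\<forall>n. data_solution \<epsilon> \<alpha> s T (\<phi> n) (u n)) \<and>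
           (\<forall>n. data_solution \<epsilon> \<alpha> s T (\<psi> n) (v n)) \<and>
           (\<exists>B. \<forall>n. sobolev_norm s (\<phi> n) \<le> B \<and> sobolev_norm s (\<psi> n) \<le> B) \<and>
           (\<lambda>n. sobolev_dist s (\<phi> n) (\<psi> n)) \<longlonglongrightarrow> 0 \<and>
           \<not> (\<lambda>n. SUP t\<in>{0..T}. ennreal (sobolev_dist s (u n t) (v n t))) \<longlonglongrightarrow> 0"
proof -
  \<comment> \<open>The shift by one keeps the mode nonzero and at least 1, as the norm bounds and
    the powers of k require.\<close>
  define k :: "nat \<Rightarrow> int" where "k n = int (Suc n)" for n
  define w1 where "w1 n = of_int (k n) powr (- 2 * s)" for n
  \<comment> \<open>The terms of \<mu> in k are shared, so the two phase speeds differ by exactly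
    \<open>pi / T\<close>.\<close>
  define w2 where "w2 n = sqrt ((w1 n)\<^sup>2 + pi / T)" for n
  define \<mu> where "\<mu> w n = w\<^sup>2 - \<epsilon> * (of_int (k n))\<^sup>2 + \<alpha> * of_int (k n) ^ 4" for w n
  define u where "u n = wave (k n) (\<mu> (w1 n) n) (soliton (w1 n))" for n
  define v where "v n = wave (k n) (\<mu> (w2 n) n) (soliton (w2 n))" for n
  define R where "R = sqrt (1 + pi / T)"
  have k: "k n \<noteq> 0" "real_of_int (k n) \<ge> 1" "\<bar>real_of_int (k n)\<bar> = real (Suc n)" for n
    by (auto simp: k_def)
  have piT: "pi / T > 0"
    using \<open>T > 0\<close> by simp
  have R: "R \<ge> 1" "R > 0"
    using piT by (auto simp: R_def)
  have w1_1: "w1 n \<ge> 1" for n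
    unfolding w1_def using k[of n] \<open>s < 0\<close> by (intro ge_one_powr_ge_zero) auto
  then have w1: "w1 n > 0" for n
    by (rule less_le_trans[OF zero_less_one])
  \<comment> \<open>Here \<open>s \<ge> - (1 / 2)\<close> enters: the exponent
    \<open>- 2 * s\<close> is at most 1, so the width does not exceed the mode.\<close>
  have "of_int (k n) powr (- 2 * s) \<le> of_int (k n) powr 1" for n
    using k[of n] assms by (intro powr_mono) auto
  then have w1_k: "w1 n \<le> \<bar>real_of_int (k n)\<bar>" for n
    by (simp add: w1_def)
  have norm1: "\<bar>real_of_int (k n)\<bar> powr (2 * s) * w1 n = 1" for n
    using k[of n] by (simp add: w1_def flip: powr_add)
  have w12: "w1 n \<le> w2 n" for n
    unfolding w2_def using piT by (intro real_le_rsqrt) simp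
  then have w2: "w2 n > 0" for n
    using w1[of n] less_le_trans by blast
  have w2_R: "w2 n \<le> R * w1 n" for n
  proof -
    have "pi / T \<le> pi / T * (w1 n)\<^sup>2"
      using mult_left_mono[of 1 "(w1 n)\<^sup>2" "pi / T"] piT w1_1[of n] by simp
    then have "w2 n \<le> sqrt ((1 + pi / T) * (w1 n)\<^sup>2)"
      unfolding w2_def by (intro real_sqrt_le_mono) (simp add: algebra_simps)
    then show ?thesis
      using w1[of n] by (simp add: real_sqrt_mult R_def)
  qed
  have norm2: "\<bar>real_of_int (k n)\<bar> powr (2 * s) * w2 n \<le> R" for n
  proof -
    have "\<bar>real_of_int (k n)\<bar> powr (2 * s) * w2 n \<le> \<bar>real_of_int (k n)\<bar> powr (2 * s) * (R * w1 n)"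
      by (intro mult_left_mono w2_R) auto
    also have "\<dots> = R * (\<bar>real_of_int (k n)\<bar> powr (2 * s) * w1 n)"
      by simp
    finally show ?thesis
      by (simp only: norm1 mult_1_right)
  qed
  have sol: "data_solution \<epsilon> \<alpha> s T (u n 0) (u n)" "data_solution \<epsilon> \<alpha> s T (v n 0) (v n)" for n
    unfolding u_def v_def using w1 w2 k \<open>s < 0\<close> by (auto intro!: data_solution_soliton simp: \<mu>_def)

  have le: "sobolev_sq s (wave (k n) m (soliton w) t) \<le> ennreal (4 * pi ^ 3 * R)"
    if "w > 0" "\<bar>real_of_int (k n)\<bar> powr (2 * s) * w \<le> R" for m w t n
  proof -
    have "sobolev_sq s (wave (k n) m (soliton w) t) \<le> ennreal (4 * pi ^ 3 * (\<bar>real_of_int (k n)\<bar> powr (2 * s) * w))"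
      using sobolev_sq_soliton_le[of w s "k n" "exp (\<i> * complex_of_real (m * t))"] that k[of n] \<open>s < 0\<close>
      by (simp add: wave_def[abs_def])
    also have "\<dots> \<le> ennreal (4 * pi ^ 3 * R)"
      using that by (intro ennreal_leI mult_left_mono) auto
    finally show ?thesis .
  qed
  have bound: "sobolev_norm s (u n 0) \<le> sqrt (4 * pi ^ 3 * R)"
    "sobolev_norm s (v n 0) \<le> sqrt (4 * pi ^ 3 * R)" for n
    unfolding u_def v_def using w1 w2 norm1 norm2 R by (intro sobolev_norm_le le; simp)+

  \<comment> \<open>This is the integral left by \<open>sobolev_sq_solitons_le\<close> for
    coefficients 1 and -1; its prefactor will be 2 by \<open>norm1\<close>.\<close>
  define D where "D n = (\<integral>\<^sup>+ \<eta>. ennreal ((cmod (sech_hat \<eta> - sech_hat (w1 n / w2 n * \<eta>)))\<^sup>2) \<partial>lborel)" for n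
  have D: "D \<longlonglongrightarrow> 0"
    unfolding D_def[abs_def]
  proof (rule sech_hat_dilation_tendsto_L2)
    \<comment> \<open>In this form the ratio visibly tends to 1, because
      \<open>inverse (w1 n)\<close> tends to 0 for \<open>s < 0\<close>.\<close>
    have ratio: "inverse (sqrt (1 + pi / T * (inverse (w1 n))\<^sup>2)) = w1 n / w2 n" for n
    proof -
      have "w2 n = sqrt ((w1 n)\<^sup>2 * (1 + pi / T * (inverse (w1 n))\<^sup>2))"
        using w1[of n] by (simp add: w2_def algebra_simps power_inverse)
      then have "w2 n = w1 n * sqrt (1 + pi / T * (inverse (w1 n))\<^sup>2)"
        using w1[of n] by (simp add: real_sqrt_mult)
      then show ?thesis
        using w1[of n] w2[of n] by (simp add: divide_inverse)
    qed
    have "(\<lambda>n. real (Suc n) powr (2 * s)) \<longlonglongrightarrow> 0"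
      using \<open>s < 0\<close>
      by (intro tendsto_neg_powr filterlim_compose[OF filterlim_real_sequentially filterlim_Suc]) auto
    also have "(\<lambda>n. real (Suc n) powr (2 * s)) = (\<lambda>n. inverse (w1 n))"
      by (simp add: w1_def k_def powr_minus)
    finally have lim: "(\<lambda>n. inverse (sqrt (1 + pi / T * (inverse (w1 n))\<^sup>2))) \<longlonglongrightarrow> inverse (sqrt (1 + pi / T * 0\<^sup>2))"
      by (intro tendsto_intros) auto
    show "(\<lambda>n. w1 n / w2 n) \<longlonglongrightarrow> 1"
      using lim unfolding ratio by simp
    \<comment> \<open>The bound \<open>w2_R\<close> keeps the ratio above \<open>inverse R\<close>,
      the uniform lower bound needed for the majorant.\<close>
    show "inverse R > 0" "inverse R \<le> w1 n / w2 n" "w1 n / w2 n \<le> 1" for n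
      using R w2_R[of n] w12[of n] w2[of n] by (auto simp: field_simps)
  qed
  have dist0: "(\<lambda>n. sobolev_dist s (u n 0) (v n 0)) \<longlonglongrightarrow> 0"
  proof -
    define S where "S n = sobolev_sq s (\<lambda>x y. u n 0 x y - v n 0 x y)" for n
    have S_le: "S n \<le> 2 * D n" for n
    proof -
      have eq: "(\<lambda>x y. u n 0 x y - v n 0 x y) = (\<lambda>x y. exp (\<i> * of_real (real_of_int (k n) * x)) *
          (1 * of_real (soliton (w1 n) y) + (-1) * of_real (soliton (w2 n) y)))"
        by (simp add: u_def v_def wave_def algebra_simps)
      have "S n \<le> ennreal (2 * (\<bar>real_of_int (k n)\<bar> powr (2 * s) * w1 n)) * D n"
        unfolding S_def eq using sobolev_sq_solitons_le[of "w1 n" "w2 n" s "k n" 1 "-1"] w1 w2 k(1) \<open>s < 0\<close>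
        by (simp add: D_def mult.assoc)
      then show ?thesis
        unfolding norm1 by simp
    qed
    have lim: "(\<lambda>n. 2 * D n) \<longlonglongrightarrow> 0"
      using ennreal_tendsto_cmult[OF _ D, of 2] by simp
    have "S \<longlonglongrightarrow> 0"
      by (rule tendsto_sandwich[OF _ _ tendsto_const lim]) (simp_all add: S_le)
    then have "(\<lambda>n. enn2real (S n)) \<longlonglongrightarrow> 0"
      by (intro tendsto_enn2real) auto
    from tendsto_real_sqrt[OF this] show ?thesis
      by (simp add: sobolev_dist_def sobolev_norm_def S_def)
  qed

  obtain b where "b > 0" and b: "\<And>n. b \<le> sobolev_dist s (u n T) (v n T)"
  proof -
    obtain d where "d > 0" and d: "\<And>(k :: int) s \<omega>1 \<omega>2 c.
      \<lbrakk>s \<le> 0; 0 < \<omega>1; \<omega>1 \<le> \<omega>2; k \<noteq> (0::int); \<omega>1 \<le> \<bar>real_of_int k\<bar>; cmod c = 1\<rbrakk> \<Longrightarrow>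
      ennreal (d * (2 + d) powr (2 * s) * (\<bar>real_of_int k\<bar> powr (2 * s) * \<omega>1))
        \<le> sobolev_sq s (\<lambda>x y. exp (\<i> * of_real (real_of_int k * x)) *
            (c * of_real (soliton \<omega>1 y) + c * of_real (soliton \<omega>2 y)))"
      using sobolev_sq_twice_soliton_ge by blast
    show thesis
    proof (rule that[of "sqrt (d * (2 + d) powr (2 * s))"])
      fix n
      define c where "c = exp (\<i> * complex_of_real (\<mu> (w1 n) n * T))"
      \<comment> \<open>At time T the phases differ by pi, so the second coefficient is
        \<open>- c\<close> and the difference of the solutions becomes a sum of solitons with equal
        coefficients.\<close>
      have "\<mu> (w2 n) n * T = \<mu> (w1 n) n * T + pi"
        using \<open>T > 0\<close> piT by (simp add: \<mu>_def w2_def add_nonneg_nonneg algebra_simps)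
      then have c2: "exp (\<i> * complex_of_real (\<mu> (w2 n) n * T)) = - c"
        by (simp add: c_def distrib_left exp_add mult.commute[of \<i> "of_real pi"])
      have eq: "(\<lambda>x y. u n T x y - v n T x y) = (\<lambda>x y. exp (\<i> * of_real (real_of_int (k n) * x)) *
          (c * of_real (soliton (w1 n) y) + c * of_real (soliton (w2 n) y)))"
        unfolding u_def v_def wave_def c2 c_def[symmetric] by (simp add: algebra_simps)
      show "sqrt (d * (2 + d) powr (2 * s)) \<le> sobolev_dist s (u n T) (v n T)"
        unfolding sobolev_dist_def eq
      proof (rule sobolev_norm_ge)
        have "cmod c = 1"
          by (simp add: c_def)
        then show "ennreal (d * (2 + d) powr (2 * s)) \<le> sobolev_sq s (\<lambda>x y. exp (\<i> * of_real (real_of_int (k n) * x)) *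
            (c * of_real (soliton (w1 n) y) + c * of_real (soliton (w2 n) y)))"
          using d[of s "w1 n" "w2 n" "k n" c] w1 w12 w1_k k(1) \<open>s < 0\<close>
          by (simp only: norm1 mult_1_right less_imp_le simp_thms)
        show "sobolev_sq s (\<lambda>x y. exp (\<i> * of_real (real_of_int (k n) * x)) *
            (c * of_real (soliton (w1 n) y) + c * of_real (soliton (w2 n) y))) < \<infinity>"
          using w1 w2 k(1) \<open>s < 0\<close> by (intro sobolev_sq_solitons_finite) auto
      qed (use \<open>d > 0\<close> in simp)
    qed (use \<open>d > 0\<close> in auto)
  qed
  have "\<not> (\<lambda>n. SUP t\<in>{0..T}. ennreal (sobolev_dist s (u n t) (v n t))) \<longlonglongrightarrow> 0"
  proof
    assume "(\<lambda>n. SUP t\<in>{0..T}. ennreal (sobolev_dist s (u n t) (v n t))) \<longlonglongrightarrow> 0"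
    then have "ennreal b \<le> 0"
    proof (rule tendsto_lowerbound)
      \<comment> \<open>The supremum is bounded below by its term at \<open>t = T\<close>, uniformly
        in n.\<close>
      have "ennreal b \<le> (SUP t\<in>{0..T}. ennreal (sobolev_dist s (u n t) (v n t)))" for n
        using b[of n] \<open>T > 0\<close> by (intro SUP_upper2[of T] ennreal_leI) auto
      then show "\<forall>\<^sub>F n in sequentially. ennreal b \<le> (SUP t\<in>{0..T}. ennreal (sobolev_dist s (u n t) (v n t)))"
        by simp
    qed simp
    with \<open>b > 0\<close> show False
      by simp
  qed
  with sol bound dist0 show ?thesis
    by (intro exI[of _ "\<lambda>n. u n 0"] exI[of _ "\<lambda>n. v n 0"] exI[of _ u] exI[of _ v]) blast
qed

end
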